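(* Let $(\varepsilon_n)_{n \geq 0}$ be the regular $\pm 1$ paperfolding sequence and let $b$ and $c$ be two positive real numbers. Then $$\prod_{n \geq 0} \left(\frac{(n+b)(n + \frac{1+c}{2})}{(n+c)(n + \frac{1+b}{2})}\right)^{\varepsilon_n} = \frac{\Gamma(\frac{c}{4})\Gamma(\frac{1}{2} + \frac{b}{4})}{\Gamma(\frac{b}{4})\Gamma(\frac{1}{2} + \frac{c}{4})},$$ where $\Gamma$ is Euler's gamma function.
   Context: The regular $\pm 1$ paperfolding sequence $(\varepsilon_n)_{n \geq 0}$ is defined by $\varepsilon_{2n} = (-1)^n$ and $\varepsilon_{2n+1} = \varepsilon_n$ for all $n \geq 0$. *)

theory Defs
  imports "HOL-Analysis.Analysis"
begin

text \<open>The regular paperfolding sequence; the defining recurrences in the usual form are the two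
  lemmas below.\<close>

function paperfolding :: "nat \<Rightarrow> int" where
  "paperfolding n = (if even n then (-1) ^ (n div 2) else paperfolding (n div 2))"
  by auto
termination
  by (relation "Wellfounded.measure id") (auto elim: oddE)

declare paperfolding.simps [simp del]

lemma paperfolding_even: "paperfolding (2 * n) = (-1) ^ n"
  by (simp add: paperfolding.simps [of "2 * n"])

lemma paperfolding_odd: "paperfolding (2 * n + 1) = paperfolding n"
  by (subst paperfolding.simps) simp

end

theory Submission
  imports Defs "HOL-Real_Asymp.Real_Asymp"
begin

text \<open>
  Put \<open>g(n) = ln ((n + b) / (n + c))\<close>. The logarithm of the \<open>n\<close>-th factor is
  \<open>\<epsilon>\<^sub>n (g(n) - g(2n + 1))\<close>. Halving the index shows that the partial sums of \<open>\<epsilon>\<close> grow slowly,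
  so by summation by parts both \<open>\<Sum> \<epsilon>\<^sub>n g(n)\<close> and \<open>\<Sum> \<epsilon>\<^sub>n g(2n + 1)\<close> converge. Splitting the first
  by the parity of \<open>n\<close> gives \<open>\<Sum> (-1)\<^sup>n g(2n)\<close> plus the second, so their difference is this alternating
  series, which the Euler limit formula for \<open>\<Gamma>\<close> evaluates.
\<close>

lemma sum_lessThan_double:
  fixes f :: "nat \<Rightarrow> 'a :: comm_monoid_add"
  shows "(\<Sum>n<2 * N. f n) = (\<Sum>n<N. f (2 * n)) + (\<Sum>n<N. f (2 * n + 1))"
  by (induction N) (simp_all add: algebra_simps)

lemma sum_alternating_eq: "(\<Sum>n<N. (-1) ^ n :: int) = (if even N then 0 else 1)"
  by (induction N) auto

definition paperfolding_sum :: "nat \<Rightarrow> int" where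
  "paperfolding_sum N = (\<Sum>n<N. paperfolding n)"

text \<open>The terms of even index form an alternating sum, which is 0 or 1, while those of odd
  index reproduce the sequence itself on half the range.\<close>

lemma paperfolding_sum_half:
  "\<bar>paperfolding_sum N\<bar> \<le> 1 + \<bar>paperfolding_sum (N div 2)\<bar>"
proof -
  define M where "M = N div 2"
  have double: "paperfolding_sum (2 * M) = (\<Sum>n<M. (-1) ^ n) + paperfolding_sum M"
    unfolding paperfolding_sum_def sum_lessThan_double
    by (simp only: paperfolding_even paperfolding_odd)
  have "paperfolding_sum (2 * M + 1) = paperfolding_sum (2 * M) + paperfolding (2 * M)"
    by (simp add: paperfolding_sum_def)
  then have "paperfolding_sum (2 * M + 1) = (\<Sum>n<Suc M. (-1) ^ n) + paperfolding_sum M"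
    by (simp add: double paperfolding_even)
  with double have "\<bar>paperfolding_sum (2 * M)\<bar> \<le> 1 + \<bar>paperfolding_sum M\<bar>"
    "\<bar>paperfolding_sum (2 * M + 1)\<bar> \<le> 1 + \<bar>paperfolding_sum M\<bar>"
    by (auto simp only: sum_alternating_eq split: if_splits)
  moreover have "N = 2 * M \<or> N = 2 * M + 1"
    unfolding M_def by presburger
  ultimately show ?thesis
    unfolding M_def [symmetric] by metis
qed

text \<open>Halving yields even logarithmic growth, but \<open>sqrt N\<close> is simpler and
  suffices: against steps of order \<open>1 / n^2\<close> it leaves a convergent series.\<close>

lemma paperfolding_sum_bound: "real_of_int \<bar>paperfolding_sum N\<bar> \<le> 4 * sqrt N"
proof (induction N rule: less_induct)
  case (less N)
  show ?case
  proof (cases "N = 0")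
    case True
    then show ?thesis by (simp add: paperfolding_sum_def)
  next
    case False
    \<comment> \<open>\<open>3 / 4\<close> is a rational upper bound for \<open>1 / sqrt 2\<close>,
      as \<open>1 / 2 \<le> 9 / 16\<close>. The factor 4 then closes the induction:
      \<open>1 + 3 * sqrt N \<le> 4 * sqrt N\<close> once \<open>N \<ge> 1\<close>.\<close>
    have "sqrt (real (N div 2)) \<le> sqrt ((3 / 4)\<^sup>2 * real N)"
      by (intro real_sqrt_le_mono) (simp add: power2_eq_square)
    also have "\<dots> = 3 / 4 * sqrt N"
      by (simp add: real_sqrt_mult)
    finally have "sqrt (real (N div 2)) \<le> 3 / 4 * sqrt N" .
    moreover have "1 \<le> sqrt N"
      using False by simp
    moreover have "real_of_int \<bar>paperfolding_sum N\<bar> \<le> 1 + real_of_int \<bar>paperfolding_sum (N div 2)\<bar>"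
      using paperfolding_sum_half [of N] by linarith
    moreover have "real_of_int \<bar>paperfolding_sum (N div 2)\<bar> \<le> 4 * sqrt (real (N div 2))"
      using False by (intro less) auto
    ultimately show ?thesis
      by linarith
  qed
qed

lemma paperfolding_sum_bigo: "(\<lambda>N. real_of_int (paperfolding_sum N)) \<in> O(\<lambda>N. sqrt (real N))"
  using paperfolding_sum_bound by (intro bigoI [of _ 4] always_eventually) simp

lemma sum_paperfolding_by_parts:
  fixes a :: "nat \<Rightarrow> real"
  shows "(\<Sum>n<N. paperfolding n * a n) =
    paperfolding_sum N * a N + (\<Sum>n<N. paperfolding_sum (Suc n) * (a n - a (Suc n)))"
  by (induction N) (simp_all add: paperfolding_sum_def algebra_simps)

text \<open>The logarithms decay only like \<open>1 / n\<close>, so convergence comes from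
  cancellation among the signs, via summation by parts.\<close>

lemma summable_paperfolding_ln:
  fixes b c :: real
  assumes "b > 0" "c > 0"
  shows "summable (\<lambda>n. paperfolding n * ln ((real n + b) / (real n + c)))"
proof -
  define a where "a = (\<lambda>n::nat. ln ((real n + b) / (real n + c)))"
  have a_eq: "a n = ln (real n + b) - ln (real n + c)" for n
    using assms by (simp add: a_def ln_div add_nonneg_pos)
  have ln_shift: "(\<lambda>n::nat. ln (real n + t) - ln (real n)) \<in> O(\<lambda>n. 1 / real n)"
    if "t > 0" for t :: real
    using that by real_asymp
  have "(\<lambda>n::nat. (ln (real n + b) - ln (real n)) - (ln (real n + c) - ln (real n))) \<in> O(\<lambda>n. 1 / real n)"
    using assms by (intro sum_in_bigo ln_shift)
  then have a_bigo: "a \<in> O(\<lambda>n. 1 / real n)"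
    by (simp add: a_eq [abs_def])
  \<comment> \<open>The leading term \<open>- 1 / n\<close> of a step does not depend on
    \<open>t\<close>, so it cancels between \<open>b\<close> and \<open>c\<close>.\<close>
  have ln_step: "(\<lambda>n::nat. ln (real n + t) - ln (real (Suc n) + t) + 1 / real n)
      \<in> O(\<lambda>n. 1 / real n ^ 2)" if "t > 0" for t :: real
    using that by real_asymp
  have "(\<lambda>n::nat. (ln (real n + b) - ln (real (Suc n) + b) + 1 / real n)
      - (ln (real n + c) - ln (real (Suc n) + c) + 1 / real n)) \<in> O(\<lambda>n. 1 / real n ^ 2)"
    using assms by (intro sum_in_bigo ln_step)
  then have a_step: "(\<lambda>n. a n - a (Suc n)) \<in> O(\<lambda>n. 1 / real n ^ 2)"
    by (simp add: a_eq algebra_simps)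
  have "(\<lambda>N. paperfolding_sum N * a N) \<in> O(\<lambda>N. sqrt (real N) * (1 / real N))"
    by (intro landau_o.big.mult paperfolding_sum_bigo a_bigo)
  also have "(\<lambda>N. sqrt (real N) * (1 / real N)) \<in> o(\<lambda>_. 1)"
    by real_asymp
  finally have boundary: "(\<lambda>N. paperfolding_sum N * a N) \<longlonglongrightarrow> 0"
    by (rule smalloD_tendsto [where g = "\<lambda>_. 1", simplified])
  have shift: "(\<lambda>n. real_of_int (paperfolding_sum (Suc n))) \<in> O(\<lambda>n. sqrt (real (Suc n)))"
    using paperfolding_sum_bigo by (rule landau_o.big.compose) (rule filterlim_Suc)
  have "(\<lambda>n. paperfolding_sum (Suc n) * (a n - a (Suc n)))
          \<in> O(\<lambda>n. sqrt (Suc n) * (1 / real n ^ 2))"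
    by (intro landau_o.big.mult shift a_step)
  also have "(\<lambda>n. sqrt (Suc n) * (1 / real n ^ 2)) \<in> O(\<lambda>n. real n powr (-3/2))"
    by real_asymp
  finally have "summable (\<lambda>n. paperfolding_sum (Suc n) * (a n - a (Suc n)))"
    by (rule summable_comparison_test_bigo [rotated]) (simp add: summable_real_powr_iff)
  then have "(\<lambda>N. paperfolding_sum N * a N
      + (\<Sum>n<N. paperfolding_sum (Suc n) * (a n - a (Suc n))))
      \<longlonglongrightarrow> 0 + (\<Sum>n. paperfolding_sum (Suc n) * (a n - a (Suc n)))"
    by (intro tendsto_add boundary summable_LIMSEQ)
  then have "(\<lambda>n. paperfolding n * a n) sums (0 + (\<Sum>n. paperfolding_sum (Suc n) * (a n - a (Suc n))))"
    unfolding sums_def sum_paperfolding_by_parts .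
  then show ?thesis
    unfolding a_def by (rule sums_summable)
qed

text \<open>In the quotient of Euler's approximations to \<open>1 / Gamma\<close> the factorials
  cancel, and \<open>balanced\<close> makes the powers of \<open>n\<close> cancel too, leaving the
  finite product.\<close>

lemma tendsto_prod_Gamma_quotient:
  fixes x y z w :: real
  assumes pos: "x > 0" "y > 0" "z > 0" "w > 0" and balanced: "x + y = z + w"
  shows "(\<lambda>N. \<Prod>k<N. ((real k + x) * (real k + y)) / ((real k + z) * (real k + w)))
    \<longlonglongrightarrow> (Gamma z * Gamma w) / (Gamma x * Gamma y)"
proof -
  let ?p = "\<lambda>N. \<Prod>k<N. ((real k + x) * (real k + y)) / ((real k + z) * (real k + w))"
  have nz: "rGamma z \<noteq> 0" "rGamma w \<noteq> 0"
    using pos by (auto simp: rGamma_eq_zero_iff elim!: nonpos_Ints_cases)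
  have "(\<lambda>n. (rGamma_series x n * rGamma_series y n) / (rGamma_series z n * rGamma_series w n))
    \<longlonglongrightarrow> (rGamma x * rGamma y) / (rGamma z * rGamma w)"
    using nz by (intro tendsto_intros) (auto simp: rGamma_series_LIMSEQ)
  moreover have "(rGamma x * rGamma y) / (rGamma z * rGamma w) = (Gamma z * Gamma w) / (Gamma x * Gamma y)"
    by (simp add: rGamma_inverse_Gamma field_simps)
  \<comment> \<open>\<open>Suc n\<close> appears because \<open>rGamma_series\<close> at
    \<open>n\<close> has the factors \<open>k = 0, ..., n\<close>. The identity also holds at
    \<open>n = 0\<close>, whatever the value of \<open>ln 0\<close>.\<close>
  moreover have "\<forall>\<^sub>F n in sequentially.
      (rGamma_series x n * rGamma_series y n) / (rGamma_series z n * rGamma_series w n) = ?p (Suc n)"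
  proof (rule always_eventually, rule allI)
    fix n :: nat
    have "exp (x * ln (real n)) * exp (y * ln (real n)) = exp (z * ln (real n)) * exp (w * ln (real n))"
      by (simp add: exp_add [symmetric] distrib_right [symmetric] balanced)
    moreover have "?p (Suc n) = (pochhammer x (Suc n) * pochhammer y (Suc n)) /
        (pochhammer z (Suc n) * pochhammer w (Suc n))"
      by (simp add: pochhammer_prod prod.distrib prod_dividef add.commute atLeast0LessThan del: prod.lessThan_Suc)
    ultimately show "(rGamma_series x n * rGamma_series y n) / (rGamma_series z n * rGamma_series w n) = ?p (Suc n)"
      by (simp add: rGamma_series_def field_simps del: prod.lessThan_Suc)
  qed
  ultimately have "(\<lambda>n. ?p (Suc n)) \<longlonglongrightarrow> (Gamma z * Gamma w) / (Gamma x * Gamma y)"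
    by (simp only: tendsto_cong)
  then show ?thesis
    by (rule LIMSEQ_imp_Suc)
qed

theorem theorem2:
  fixes b c :: real
  assumes "b > 0" and "c > 0"
  shows "(\<lambda>n::nat. (((real n + b) * (real n + (1 + c) / 2)) /
                    ((real n + c) * (real n + (1 + b) / 2))) powi paperfolding n)
         has_prod
         ((Gamma (c / 4) * Gamma (1 / 2 + b / 4)) / (Gamma (b / 4) * Gamma (1 / 2 + c / 4)))"
    (is "?f has_prod ?P")
proof -
  define g where "g = (\<lambda>n::nat. ln ((real n + b) / (real n + c)))"
  \<comment> \<open>Cancelling 2 gives \<open>g\<close> at odd indices the same shape with
    parameters \<open>(1 + b) / 2\<close> and \<open>(1 + c) / 2\<close>, so the summability lemma
    applies to it as well.\<close>
  have g_odd: "g (2 * n + 1) = ln ((real n + (1 + b) / 2) / (real n + (1 + c) / 2))" for n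
  proof -
    have "real (2 * n + 1) + t = 2 * (real n + (1 + t) / 2)" for t :: real
      by (simp add: field_simps)
    then show ?thesis
      unfolding g_def by (simp only: mult_divide_mult_cancel_left_if) simp
  qed
  have sum_g: "summable (\<lambda>n. paperfolding n * g n)"
    unfolding g_def using assms by (rule summable_paperfolding_ln)
  have sum_odd: "summable (\<lambda>n. paperfolding n * g (2 * n + 1))"
    unfolding g_odd using assms by (intro summable_paperfolding_ln) auto
  define D where "D = (\<Sum>n. paperfolding n * g n) - (\<Sum>n. paperfolding n * g (2 * n + 1))"
  have D_sums: "(\<lambda>n. paperfolding n * g n - paperfolding n * g (2 * n + 1)) sums D"
    unfolding D_def using sum_g sum_odd by (intro sums_diff summable_sums)

  \<comment> \<open>Cutting the first series at \<open>2 * N\<close> and the second at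
    \<open>N\<close> makes the odd-index part cancel exactly.\<close>
  have split: "(\<Sum>n<2 * N. paperfolding n * g n) - (\<Sum>n<N. paperfolding n * g (2 * n + 1))
      = (\<Sum>n<N. (-1) ^ n * g (2 * n))" for N
    unfolding sum_lessThan_double by (simp only: paperfolding_even paperfolding_odd) simp
  have "(\<lambda>N. (\<Sum>n<2 * N. paperfolding n * g n) - (\<Sum>n<N. paperfolding n * g (2 * n + 1)))
      \<longlonglongrightarrow> D"
    unfolding D_def using sum_g sum_odd
    by (intro tendsto_diff summable_LIMSEQ
        filterlim_compose [OF summable_LIMSEQ [OF sum_g]] filterlim_subseq)
       (auto simp: strict_mono_def)
  then have "(\<lambda>N. \<Sum>n<N. (-1) ^ n * g (2 * n)) \<longlonglongrightarrow> D"
    unfolding split .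
  \<comment> \<open>An even number of terms lets neighbours of opposite sign be paired, at arguments
    \<open>4 * k\<close> and \<open>4 * k + 2\<close> of \<open>g\<close>.\<close>
  then have "(\<lambda>N. \<Sum>n<2 * N. (-1) ^ n * g (2 * n)) \<longlonglongrightarrow> D"
    by (rule filterlim_compose) (auto intro: filterlim_subseq simp: strict_mono_def)
  then have lim_D: "(\<lambda>N. exp (\<Sum>n<2 * N. (-1) ^ n * g (2 * n))) \<longlonglongrightarrow> exp D"
    by (rule tendsto_exp)

  have pair: "exp (g (4 * k) - g (4 * k + 2)) =
      ((real k + b / 4) * (real k + (1 / 2 + c / 4))) /
      ((real k + c / 4) * (real k + (1 / 2 + b / 4)))" for k
  proof -
    have "exp (g (4 * k) - g (4 * k + 2)) =
        ((real (4 * k) + b) / (real (4 * k) + c)) /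
        ((real (4 * k + 2) + b) / (real (4 * k + 2) + c))"
      using assms by (simp add: g_def exp_diff add_nonneg_pos)
    also have "\<dots> = ((4 * (real k + b / 4)) / (4 * (real k + c / 4))) /
        ((4 * (real k + (1 / 2 + b / 4))) / (4 * (real k + (1 / 2 + c / 4))))"
      by (simp add: algebra_simps)
    finally show ?thesis
      by (simp only: mult_divide_mult_cancel_left_if) simp
  qed
  have "exp (\<Sum>n<2 * N. (-1) ^ n * g (2 * n)) =
      (\<Prod>k<N. ((real k + b / 4) * (real k + (1 / 2 + c / 4))) /
        ((real k + c / 4) * (real k + (1 / 2 + b / 4))))" for N
  proof -
    have "(\<Sum>n<2 * N. (-1) ^ n * g (2 * n)) = (\<Sum>k<N. g (4 * k) - g (4 * k + 2))"
      unfolding sum_lessThan_double by (simp add: sum_subtractf sum_negf)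
    then show ?thesis
      by (simp only: exp_sum finite_lessThan pair)
  qed
  with lim_D have "(\<lambda>N. \<Prod>k<N. ((real k + b / 4) * (real k + (1 / 2 + c / 4))) /
        ((real k + c / 4) * (real k + (1 / 2 + b / 4)))) \<longlonglongrightarrow> exp D"
    by simp
  \<comment> \<open>The balance condition holds: both pairs of shifts add up to
    \<open>1 / 2 + b / 4 + c / 4\<close>.\<close>
  moreover have "(\<lambda>N. \<Prod>k<N. ((real k + b / 4) * (real k + (1 / 2 + c / 4))) /
        ((real k + c / 4) * (real k + (1 / 2 + b / 4)))) \<longlonglongrightarrow> ?P"
    using assms by (intro tendsto_prod_Gamma_quotient) auto
  ultimately have exp_D: "exp D = ?P"
    by (rule LIMSEQ_unique)

  \<comment> \<open>Exponentiating turns the series with sum \<open>D\<close> into the product;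
    positivity of the base identifies each exponential with an integer power.\<close>
  have "exp (paperfolding n * g n - paperfolding n * g (2 * n + 1)) = ?f n" for n
  proof -
    have pos: "real n + b > 0" "real n + c > 0" "real n + (1 + b) / 2 > 0" "real n + (1 + c) / 2 > 0"
      using assms by (auto simp: add_nonneg_pos)
    have "g n - g (2 * n + 1) = ln (((real n + b) * (real n + (1 + c) / 2)) /
                    ((real n + c) * (real n + (1 + b) / 2)))" (is "_ = ln ?q")
      unfolding g_odd unfolding g_def using pos by (simp add: ln_div ln_mult)
    then have "paperfolding n * g n - paperfolding n * g (2 * n + 1) = paperfolding n * ln ?q"
      by (simp add: right_diff_distrib [symmetric])
    moreover have "?q > 0"
      using pos by (intro divide_pos_pos mult_pos_pos)
    ultimately show ?thesis
      by (simp only: exp_power_int [symmetric] exp_ln)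
  qed
  with sums_imp_has_prod_exp [OF D_sums] exp_D show ?thesis
    by (simp add: has_prod_def)
qed

end
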